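(* Let $p\in\mathbb{R}[x_1,\dots,x_n]$ be a homogeneous symmetric polynomial of degree $d$ with $p(\vec 1)\ne0$. Then $p$ is symmetric hyperbolic if and only if for every $x\in\mathbb{R}^n$ with at most $d-1$ distinct entries, the univariate polynomial $p(x+t\vec 1)$ in $t$ has only real roots.
   Context: $\vec 1=(1,\dots,1)\in\mathbb{R}^n$. A homogeneous $p$ is hyperbolic with respect to $v\in\mathbb{R}^n$ if $p(v)\ne0$ and for every $x\in\mathbb{R}^n$ the univariate polynomial $p(x+tv)$ in $t$ has only real roots. $p$ is symmetric hyperbolic if it is invariant under all permutations of the variables and hyperbolic with respect to $\vec 1$. A vector has at most $m$ distinct entries if the set of values of its coordinates has at most $m$ elements.
   Formalization: The case d = 2 with n ≥ 2 is excluded: there the condition on vectors with at most one distinct entry always holds, while x_1^2+...+x_n^2 is symmetric with p(1) ≠ 0 but not hyperbolic. *)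

theory Defs
  imports
    "HOL-Analysis.Analysis"
    "HOL-Library.Poly_Mapping"
    "HOL-Computational_Algebra.Polynomial"
begin

text \<open>Real polynomials in variables indexed by the finite type \<open>'n\<close>: a monomial is the exponent
  map \<open>'n \<Rightarrow>\<^sub>0 nat\<close>, a polynomial the finitely supported map from monomials to coefficients.\<close>

type_synonym 'n real_mpoly = "('n \<Rightarrow>\<^sub>0 nat) \<Rightarrow>\<^sub>0 real"

definition eval_mpoly :: "'n::finite real_mpoly \<Rightarrow> real ^ 'n \<Rightarrow> real" where
  "eval_mpoly p x =
     (\<Sum>m\<in>Poly_Mapping.keys p. Poly_Mapping.lookup p m * (\<Prod>i\<in>UNIV. x $ i ^ Poly_Mapping.lookup m i))"

definition homogeneous :: "nat \<Rightarrow> 'n::finite real_mpoly \<Rightarrow> bool" where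
  "homogeneous d p \<longleftrightarrow> (\<forall>m\<in>Poly_Mapping.keys p. (\<Sum>i\<in>UNIV. Poly_Mapping.lookup m i) = d)"

text \<open>For a bijection \<open>\<sigma>\<close>, \<open>map_key \<sigma> m\<close> is the monomial with exponents \<open>i \<mapsto> m (\<sigma> i)\<close>, i.e. \<open>m\<close>
  with its variables permuted.\<close>

definition symmetric :: "'n::finite real_mpoly \<Rightarrow> bool" where
  "symmetric p \<longleftrightarrow>
     (\<forall>\<sigma>. bij \<sigma> \<longrightarrow>
       (\<forall>m. Poly_Mapping.lookup p (Poly_Mapping.map_key \<sigma> m) = Poly_Mapping.lookup p m))"

text \<open>The univariate polynomial \<open>p(x + t v)\<close> in \<open>t\<close>, obtained by substituting \<open>x\<^sub>i + v\<^sub>i t\<close> for the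
  \<open>i\<close>-th variable.\<close>

definition line_poly :: "'n::finite real_mpoly \<Rightarrow> real ^ 'n \<Rightarrow> real ^ 'n \<Rightarrow> real poly" where
  "line_poly p x v =
     (\<Sum>m\<in>Poly_Mapping.keys p.
        smult (Poly_Mapping.lookup p m) (\<Prod>i\<in>UNIV. [:x $ i, v $ i:] ^ Poly_Mapping.lookup m i))"

lemma poly_line_poly: "poly (line_poly p x v) t = eval_mpoly p (x + t *\<^sub>R v)"
  by (simp add: line_poly_def eval_mpoly_def poly_sum poly_prod)

definition only_real_roots :: "real poly \<Rightarrow> bool" where
  "only_real_roots q \<longleftrightarrow> (\<forall>z::complex. poly (map_poly of_real q) z = 0 \<longrightarrow> z \<in> \<real>)"

definition hyperbolic :: "'n::finite real_mpoly \<Rightarrow> real ^ 'n \<Rightarrow> bool" where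
  "hyperbolic p v \<longleftrightarrow>
     (\<exists>d. homogeneous d p) \<and> eval_mpoly p v \<noteq> 0 \<and> (\<forall>x. only_real_roots (line_poly p x v))"

text \<open>Here \<open>1 :: real ^ 'n\<close> is the all-ones vector.\<close>

definition symmetric_hyperbolic :: "'n::finite real_mpoly \<Rightarrow> bool" where
  "symmetric_hyperbolic p \<longleftrightarrow> symmetric p \<and> hyperbolic p 1"

definition at_most_distinct_entries :: "nat \<Rightarrow> real ^ 'n::finite \<Rightarrow> bool" where
  "at_most_distinct_entries k x \<longleftrightarrow> card (range (\<lambda>i. x $ i)) \<le> k"

end

theory Submission
  imports Defs "HOL-Computational_Algebra.Fundamental_Theorem_Algebra"
begin

text \<open>Fix \<open>x\<close> and let \<open>K\<close> be the compact set of points having the same power sums of order less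
  than \<open>d\<close> as \<open>x\<close>. On \<open>K\<close> the polynomials \<open>p(y + t 1)\<close> in \<open>t\<close> differ only in their constant term,
  which depends affinely on the \<open>d\<close>-th power sum. The \<open>d\<close>-th power sum attains its extrema over
  \<open>K\<close> at points where the gradients of the first \<open>d\<close> power sums are dependent, that is, at points
  with at most \<open>d - 1\<close> distinct entries. So \<open>p(x + t 1)\<close> lies between two real-rooted polynomials
  differing by a constant, and is real-rooted because \<open>q'\<close> interlaces both of them. Compactness
  uses the second power sum, hence \<open>d \<ge> 3\<close>.\<close>

section \<open>Real-rootedness via the upper half plane\<close>

text \<open>The product is |f(z)|^2 times the logarithmic derivative, the sum of 1/(z - w) over the
  roots w, and each such term has negative imaginary part for real w. Without the division, the
  expression is affine in a real constant added to \<open>f\<close>.\<close>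

lemma Im_pderiv_mult_cnj:
  fixes f :: "complex poly"
  assumes "\<And>w. poly f w = 0 \<Longrightarrow> w \<in> \<real>" and "Im z > 0"
  shows "Im (poly (pderiv f) z * cnj (poly f z)) \<le> 0 \<and>
    (degree f > 0 \<longrightarrow> Im (poly (pderiv f) z * cnj (poly f z)) < 0)"
  using assms(1)
proof (induction "degree f" arbitrary: f)
  case 0
  then show ?case by (metis pderiv_eq_0_iff poly_0 mult_zero_left zero_complex.sel(2) order_refl less_irrefl)
next
  case (Suc n)
  have "\<not> constant (poly f)"
    using Suc.hyps(2) by (simp add: constant_degree)
  then obtain w where w: "poly f w = 0"
    using fundamental_theorem_of_algebra by blast
  then have "w \<in> \<real>" by (rule Suc.prems)
  obtain g where g: "f = [:-w, 1:] * g"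
    using w by (metis poly_eq_0_iff_dvd dvdE)
  have "g \<noteq> 0" using g Suc.hyps(2) by auto
  then have "degree f = Suc (degree g)"
    unfolding g by (subst degree_mult_eq) auto
  then have IH: "Im (poly (pderiv g) z * cnj (poly g z)) \<le> 0"
    using Suc.hyps(1)[of g] Suc.hyps(2) Suc.prems g by auto
  have "poly g z \<noteq> 0"
    using Suc.prems[of z] assms(2) g by (auto simp: complex_is_Real_iff)
  then have pos: "(cmod (poly g z))\<^sup>2 * Im z > 0" using assms(2) by simp
  have "pderiv f = g + [:-w, 1:] * pderiv g"
    unfolding g pderiv_mult by (simp add: pderiv_pCons algebra_simps)
  then have "poly (pderiv f) z = poly g z + (z - w) * poly (pderiv g) z"
    by (simp only: poly_add poly_mult poly_pCons poly_0) simp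
  moreover have "poly f z = (z - w) * poly g z" by (simp add: g algebra_simps)
  ultimately have "poly (pderiv f) z * cnj (poly f z) =
      (poly g z + (z - w) * poly (pderiv g) z) * cnj ((z - w) * poly g z)"
    by (simp only:)
  also have "\<dots> = poly g z * cnj (poly g z) * cnj (z - w)
      + (z - w) * cnj (z - w) * (poly (pderiv g) z * cnj (poly g z))"
    by (simp add: algebra_simps)
  finally have "poly (pderiv f) z * cnj (poly f z) =
      of_real ((cmod (poly g z))\<^sup>2) * cnj (z - w)
      + of_real ((cmod (z - w))\<^sup>2) * (poly (pderiv g) z * cnj (poly g z))"
    by (simp only: complex_norm_square)
  \<comment> \<open>As \<open>w\<close> is real, \<open>Im (cnj (z - w)) = - Im z\<close>: the
    split-off root contributes a strictly negative term, and \<open>IH\<close> bounds the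
    rest.\<close>
  then have "Im (poly (pderiv f) z * cnj (poly f z)) =
      - ((cmod (poly g z))\<^sup>2 * Im z)
      + (cmod (z - w))\<^sup>2 * Im (poly (pderiv g) z * cnj (poly g z))"
    using \<open>w \<in> \<real>\<close> by (simp only: plus_complex.sel Im_complex_of_real Re_complex_of_real
        times_complex.sel complex_is_Real_iff) (simp add: complex_is_Real_iff)
  moreover have "(cmod (z - w))\<^sup>2 * Im (poly (pderiv g) z * cnj (poly g z)) \<le> 0"
    using IH by (simp add: mult_nonneg_nonpos)
  ultimately show ?case using pos by linarith
qed

text \<open>Nonreal roots of a real polynomial come in conjugate pairs, one of each pair in the
  upper half plane.\<close>

lemma only_real_roots_upper_half_plane:
  assumes "\<And>z. Im z > 0 \<Longrightarrow> poly (map_poly complex_of_real q) z \<noteq> 0"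
  shows "only_real_roots q"
  unfolding only_real_roots_def
proof (intro allI impI)
  fix z assume z: "poly (map_poly complex_of_real q) z = 0"
  have "poly (map_poly complex_of_real q) (cnj z) = cnj (poly (map_poly complex_of_real q) z)"
    by (subst poly_cnj_real) (auto simp: coeff_map_poly)
  then have "poly (map_poly complex_of_real q) (cnj z) = 0" using z by simp
  then have "\<not> Im (cnj z) > 0" "\<not> Im z > 0" using assms z by blast+
  then show "z \<in> \<real>" by (simp add: complex_is_Real_iff)
qed

text \<open>For \<open>z\<close> in the upper half plane, \<open>Im (q'(z) \<cdot> cnj (q(z) + c))\<close> is affine in \<open>c\<close>
  and negative at \<open>c = a\<close> and \<open>c = b\<close>.\<close>

lemma only_real_roots_between:
  assumes deg: "degree q > 0"
    and "only_real_roots (q + [:a:])" and "only_real_roots (q + [:b:])"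
    and "a \<le> c" and "c \<le> b"
  shows "only_real_roots (q + [:c:])"
proof (rule only_real_roots_upper_half_plane)
  fix z :: complex assume z: "Im z > 0"
  define Q where "Q = map_poly complex_of_real q"
  have map: "map_poly complex_of_real (q + [:s:]) = Q + [:of_real s:]" for s
    by (rule poly_eqI) (simp add: Q_def coeff_map_poly coeff_pCons split: nat.splits)
  define L where "L s = Im (poly (pderiv Q) z * cnj (poly Q z)) + s * Im (poly (pderiv Q) z)" for s
  have L: "Im (poly (pderiv Q) z * cnj (poly (map_poly complex_of_real (q + [:s:])) z)) = L s" for s
    by (simp add: map L_def algebra_simps)
  \<comment> \<open>Positive degree makes the sign strict; the shift by \<open>s\<close> changes
    neither the degree nor the derivative.\<close>
  have neg: "L s < 0" if "only_real_roots (q + [:s:])" for s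
  proof -
    have "degree (Q + [:of_real s:]) > 0"
    proof -
      have "degree Q = degree q" unfolding Q_def by (simp add: degree_map_poly)
      then show ?thesis using deg by (subst degree_add_eq_left) auto
    qed
    moreover have "pderiv (Q + [:of_real s:]) = pderiv Q"
      by (simp add: pderiv_add pderiv_pCons)
    ultimately show ?thesis
      using Im_pderiv_mult_cnj[of "map_poly complex_of_real (q + [:s:])" z] that z
      by (simp add: map only_real_roots_def flip: L)
  qed
  have "L a < 0" "L b < 0" using assms neg by auto
  \<comment> \<open>The sign of the slope decides which endpoint bounds the affine function
    \<open>L\<close>.\<close>
  moreover have "L c \<le> max (L a) (L b)"
  proof (cases "Im (poly (pderiv Q) z) \<ge> 0")
    case True
    then have "c * Im (poly (pderiv Q) z) \<le> b * Im (poly (pderiv Q) z)"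
      using assms by (intro mult_right_mono)
    then show ?thesis by (simp add: L_def)
  next
    case False
    then have "c * Im (poly (pderiv Q) z) \<le> a * Im (poly (pderiv Q) z)"
      using assms by (intro mult_right_mono_neg) auto
    then show ?thesis by (simp add: L_def)
  qed
  ultimately have "L c < 0" by auto
  then show "poly (map_poly complex_of_real (q + [:c:])) z \<noteq> 0"
    using L[of c] by auto
qed

lemma only_real_roots_degree_le_1:
  assumes "degree q \<le> 1" "q \<noteq> 0"
  shows "only_real_roots q"
proof -
  have q: "q = [:coeff q 0, coeff q 1:]"
    using assms(1) by (intro poly_eqI) (auto simp: coeff_pCons coeff_eq_0 split: nat.splits)
  show ?thesis
  proof (rule only_real_roots_upper_half_plane)
    fix z :: complex assume "Im z > 0"
    moreover have "coeff q 0 \<noteq> 0 \<or> coeff q 1 \<noteq> 0"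
      using assms(2) q by (metis pCons_0_0)
    ultimately show "poly (map_poly complex_of_real q) z \<noteq> 0"
      by (subst q) (auto simp: map_poly_pCons complex_eq_iff)
  qed
qed

section \<open>Power sums and symmetrized monomials\<close>

definition psum :: "nat \<Rightarrow> real ^ 'n::finite \<Rightarrow> real" where
  "psum k x = (\<Sum>i\<in>UNIV. x $ i ^ k)"

text \<open>Binomial expansion in each coordinate; in particular, points with equal power sums up to
  order \<open>k\<close> keep them equal under a common shift.\<close>

lemma psum_shift:
  fixes x :: "real ^ 'n::finite"
  shows "psum k (x + t *\<^sub>R 1) = (\<Sum>j\<le>k. of_nat (k choose j) * t ^ (k - j) * psum j x)"
proof -
  have "psum k (x + t *\<^sub>R 1) =
      (\<Sum>i\<in>UNIV. \<Sum>j\<le>k. of_nat (k choose j) * x $ i ^ j * t ^ (k - j))"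
    by (simp add: psum_def binomial_ring)
  also have "\<dots> = (\<Sum>j\<le>k. \<Sum>i\<in>UNIV. of_nat (k choose j) * x $ i ^ j * t ^ (k - j))"
    by (rule sum.swap)
  finally show ?thesis by (simp add: psum_def sum_distrib_left mult_ac)
qed

text \<open>In \<open>psum_shift\<close> the terms below order \<open>d\<close> cancel, and the one
  of order \<open>d\<close> has coefficient 1, so no \<open>t\<close> remains.\<close>

lemma psum_shift_diff:
  assumes "\<And>k. k < d \<Longrightarrow> psum k x = psum k y"
  shows "psum d (y + t *\<^sub>R 1) - psum d (x + t *\<^sub>R 1) = psum d y - psum d x"
proof -
  have split: "{..d} = insert d {..<d}" by auto
  show ?thesis using assms by (simp add: psum_shift split)
qed

text \<open>A positive multiple of the monomial symmetric polynomial of \<open>m\<close>: each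
  distinct monomial is counted as often as the stabilizer of \<open>m\<close> has elements.\<close>

definition perm_sum :: "('n \<Rightarrow> nat) \<Rightarrow> real ^ 'n::finite \<Rightarrow> real" where
  "perm_sum m x = (\<Sum>\<sigma> | bij \<sigma>. \<Prod>i\<in>UNIV. x $ \<sigma> i ^ m i)"

lemma perm_sum_permute:
  assumes "bij \<tau>"
  shows "perm_sum (m \<circ> \<tau>) x = perm_sum m x"
  unfolding perm_sum_def
proof (rule sum.reindex_bij_witness[where i = "\<lambda>\<sigma>. \<sigma> \<circ> \<tau>" and j = "\<lambda>\<sigma>. \<sigma> \<circ> inv \<tau>"])
  fix \<sigma> :: "'a \<Rightarrow> 'a" assume "\<sigma> \<in> {\<sigma>. bij \<sigma>}"
  then show "\<sigma> \<circ> inv \<tau> \<in> {\<sigma>. bij \<sigma>}" "\<sigma> \<circ> \<tau> \<in> {\<sigma>. bij \<sigma>}"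
    using assms by (auto intro: bij_comp bij_imp_bij_inv)
  show "\<sigma> \<circ> inv \<tau> \<circ> \<tau> = \<sigma>" "\<sigma> \<circ> \<tau> \<circ> inv \<tau> = \<sigma>"
    using assms by (auto simp: fun_eq_iff bij_is_inj bij_is_surj surj_f_inv_f)
  have "(\<Prod>i\<in>UNIV. x $ (\<sigma> \<circ> inv \<tau>) (\<tau> i) ^ m (\<tau> i)) =
      (\<Prod>i\<in>UNIV. x $ (\<sigma> \<circ> inv \<tau>) i ^ m i)"
    using assms by (rule prod.reindex_bij_betw)
  then show "(\<Prod>i\<in>UNIV. x $ (\<sigma> \<circ> inv \<tau>) i ^ m i) = (\<Prod>i\<in>UNIV. x $ \<sigma> i ^ (m \<circ> \<tau>) i)"
    using assms by (simp add: bij_is_inj)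
qed

text \<open>In the summand of \<open>\<sigma>\<close>, write \<open>psum a x\<close> as the sum of
  all \<open>x $ \<sigma> j ^ a\<close>; the factor for \<open>j\<close> raises the exponent at
  \<open>j\<close> by \<open>a\<close>.\<close>

lemma psum_mult_perm_sum:
  "psum a x * perm_sum m x = (\<Sum>j\<in>UNIV. perm_sum (m(j := m j + a)) x)"
proof -
  have *: "perm_sum (m(j := m j + a)) x =
      (\<Sum>\<sigma> | bij \<sigma>. x $ \<sigma> j ^ a * (\<Prod>i\<in>UNIV. x $ \<sigma> i ^ m i))" for j
    unfolding perm_sum_def
  proof (rule sum.cong[OF refl])
    fix \<sigma> :: "'a \<Rightarrow> 'a"
    have "(\<Prod>i\<in>UNIV. x $ \<sigma> i ^ (m(j := m j + a)) i) =
        x $ \<sigma> j ^ (m j + a) * (\<Prod>i\<in>UNIV - {j}. x $ \<sigma> i ^ (m(j := m j + a)) i)"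
      by (subst prod.remove[of _ j]) auto
    also have "(\<Prod>i\<in>UNIV - {j}. x $ \<sigma> i ^ (m(j := m j + a)) i) = (\<Prod>i\<in>UNIV - {j}. x $ \<sigma> i ^ m i)"
      by (rule prod.cong) auto
    also have "x $ \<sigma> j ^ (m j + a) * \<dots> = x $ \<sigma> j ^ a * (\<Prod>i\<in>UNIV. x $ \<sigma> i ^ m i)"
      by (subst prod.remove[of UNIV j]) (auto simp: power_add)
    finally show "(\<Prod>i\<in>UNIV. x $ \<sigma> i ^ (m(j := m j + a)) i) =
        x $ \<sigma> j ^ a * (\<Prod>i\<in>UNIV. x $ \<sigma> i ^ m i)" .
  qed
  have "(\<Sum>j\<in>UNIV. perm_sum (m(j := m j + a)) x) =
      (\<Sum>\<sigma> | bij \<sigma>. (\<Sum>j\<in>UNIV. x $ \<sigma> j ^ a) * (\<Prod>i\<in>UNIV. x $ \<sigma> i ^ m i))"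
    unfolding * by (subst sum.swap) (simp add: sum_distrib_right)
  also have "\<dots> = (\<Sum>\<sigma> | bij \<sigma>. psum a x * (\<Prod>i\<in>UNIV. x $ \<sigma> i ^ m i))"
  proof (rule sum.cong[OF refl])
    fix \<sigma> :: "'a \<Rightarrow> 'a" assume "\<sigma> \<in> {\<sigma>. bij \<sigma>}"
    then have "(\<Sum>j\<in>UNIV. x $ \<sigma> j ^ a) = psum a x"
      unfolding psum_def by (intro sum.reindex_bij_betw[where g = "\<lambda>i. x $ i ^ a"]) simp
    then show "(\<Sum>j\<in>UNIV. x $ \<sigma> j ^ a) * (\<Prod>i\<in>UNIV. x $ \<sigma> i ^ m i) =
        psum a x * (\<Prod>i\<in>UNIV. x $ \<sigma> i ^ m i)" by simp
  qed
  finally show ?thesis by (simp add: perm_sum_def sum_distrib_left)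
qed

text \<open>In the product of \<open>psum (m i0)\<close> and \<open>perm_sum m'\<close>, an index
  where \<open>m'\<close> vanishes gives back \<open>m\<close> up to a transposition, and any other
  index merges two exponents. All monomials on the right involve fewer variables than
  \<open>m\<close>.\<close>

lemma perm_sum_split_off:
  assumes "m i0 > 0"
  defines "m' \<equiv> m(i0 := 0)"
  shows "real (card {j. m' j = 0}) * perm_sum m x =
    psum (m i0) x * perm_sum m' x - (\<Sum>j | m' j > 0. perm_sum (m'(j := m' j + m i0)) x)"
proof -
  have same: "perm_sum (m'(j := m' j + m i0)) x = perm_sum m x" if "m' j = 0" for j
  proof -
    have "m'(j := m' j + m i0) = m \<circ> Transposition.transpose i0 j"
      using that by (auto simp: m'_def fun_eq_iff Transposition.transpose_def split: if_splits)
    then show ?thesis by (simp add: perm_sum_permute)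
  qed
  have "psum (m i0) x * perm_sum m' x =
      (\<Sum>j\<in>{j. m' j = 0} \<union> {j. m' j > 0}. perm_sum (m'(j := m' j + m i0)) x)"
    unfolding psum_mult_perm_sum by (rule sum.cong) auto
  also have "\<dots> = (\<Sum>j | m' j = 0. perm_sum (m'(j := m' j + m i0)) x) +
      (\<Sum>j | m' j > 0. perm_sum (m'(j := m' j + m i0)) x)"
    by (rule sum.union_disjoint) auto
  also have "(\<Sum>j | m' j = 0. perm_sum (m'(j := m' j + m i0)) x) =
      (\<Sum>j | m' j = 0. perm_sum m x)"
    by (rule sum.cong) (use same in auto)
  finally show ?thesis by (simp only: sum_constant)
qed

text \<open>By repeatedly splitting off a power sum, a symmetric polynomial of degree at most \<open>d\<close> is a polynomial
  in the first \<open>d\<close> power sums in which \<open>psum d\<close> enters linearly with a constant coefficient,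
  vanishing in degree less than \<open>d\<close>. Only the consequence for points sharing the lower power
  sums is needed.\<close>

lemma perm_sum_affine_in_psum:
  fixes m :: "'n::finite \<Rightarrow> nat"
  assumes "sum m UNIV \<le> d"
  shows "\<exists>c. (sum m UNIV < d \<longrightarrow> c = 0) \<and>
    (\<forall>x y :: real ^ 'n. (\<forall>k<d. psum k x = psum k y) \<longrightarrow>
      perm_sum m y - perm_sum m x = c * (psum d y - psum d x))"
  using assms
proof (induction "card {i. m i > 0}" arbitrary: m rule: less_induct)
  case less
  show ?case
  proof (cases "\<exists>i0. m i0 > 0")
    case False
    then show ?thesis by (intro exI[of _ 0]) (simp add: perm_sum_def)
  next
    case True
    then obtain i0 where i0: "m i0 > 0" ..
    define m' where "m' = m(i0 := 0)"
    define a where "a = m i0"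
    define N where "N = real (card {j. m' j = 0})"
    have "i0 \<in> {j. m' j = 0}" by (simp add: m'_def)
    then have N: "N > 0" unfolding N_def by (auto simp: card_gt_0_iff)
    have sum_m: "sum m UNIV = a + sum m' UNIV"
      unfolding a_def m'_def by (simp add: sum.remove[of UNIV i0])
    have supp: "{i. m i > 0} = insert i0 {i. m' i > 0}" "i0 \<notin> {i. m' i > 0}"
      using i0 by (auto simp: m'_def)
    then have card': "card {i. m' i > 0} < card {i. m i > 0}" by simp
    \<comment> \<open>\<open>R j c\<close> makes \<open>c\<close> a valid slope for the monomial
      with \<open>a\<close> merged into index \<open>j\<close>, which has the total degree of
      \<open>m\<close> but lacks \<open>i0\<close>.\<close>
    define R where "R j c \<longleftrightarrow> (sum m UNIV < d \<longrightarrow> c = 0) \<and>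
        (\<forall>x y :: real ^ 'n. (\<forall>k<d. psum k x = psum k y) \<longrightarrow>
          perm_sum (m'(j := m' j + a)) y - perm_sum (m'(j := m' j + a)) x = c * (psum d y - psum d x))"
      for j c
    have "\<exists>c. R j c" if "m' j > 0" for j
    proof -
      have "sum (m'(j := m' j + a)) UNIV = sum m UNIV"
        unfolding sum_m by (simp add: sum.remove[of UNIV j])
      moreover have "{i. (m'(j := m' j + a)) i > 0} = {i. m' i > 0}" using that by auto
      ultimately show ?thesis
        using less.hyps[of "m'(j := m' j + a)"] card' less.prems by (simp add: R_def)
    qed
    then obtain c where R: "\<And>j. m' j > 0 \<Longrightarrow> R j (c j)" by metis
    have c: "sum m UNIV < d \<Longrightarrow> c j = 0"
      "(\<forall>k<d. psum k x = psum k y) \<Longrightarrow>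
        perm_sum (m'(j := m' j + a)) y - perm_sum (m'(j := m' j + a)) x = c j * (psum d y - psum d x)"
      if "m' j > 0" for j and x y :: "real ^ 'n"
      using R[OF that] unfolding R_def by blast+
    \<comment> \<open>Removing a positive exponent brings the degree below \<open>d\<close>, so the
      slope of \<open>perm_sum m'\<close> is zero.\<close>
    have "sum m' UNIV < d" using less.prems sum_m i0 a_def by simp
    moreover obtain c' where "sum m' UNIV < d \<longrightarrow> c' = 0"
      and c': "\<forall>x y :: real ^ 'n. (\<forall>k<d. psum k x = psum k y) \<longrightarrow>
          perm_sum m' y - perm_sum m' x = c' * (psum d y - psum d x)"
      using less.hyps[of m'] card' less.prems sum_m by auto
    ultimately have "c' = 0" by simp
    then have perm': "perm_sum m' y = perm_sum m' x"
      if "\<forall>k<d. psum k (x :: real ^ 'n) = psum k y" for x y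
      using c'[rule_format, of x y] that by simp
    \<comment> \<open>The slope of the product \<open>psum a * perm_sum m'\<close>: if
      \<open>a = d\<close>, then \<open>m'\<close> is zero and \<open>perm_sum m'\<close> is
      constant, so its value at 0 serves; if \<open>a < d\<close>, both factors agree at
      \<open>x\<close> and \<open>y\<close>.\<close>
    define e where "e = (if a = d then perm_sum m' (0 :: real ^ 'n) else 0)"
    have prod: "psum a y * perm_sum m' y - psum a x * perm_sum m' x = e * (psum d y - psum d x)"
      if xy: "\<forall>k<d. psum k (x :: real ^ 'n) = psum k y" for x y
    proof (cases "a = d")
      case True
      then have "sum m' UNIV = 0" using less.prems sum_m by simp
      then have "m' i = 0" for i by simp
      then have "perm_sum m' z = perm_sum m' 0" for z :: "real ^ 'n"
        by (simp add: perm_sum_def)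
      then have "perm_sum m' x = perm_sum m' 0" "perm_sum m' y = perm_sum m' 0" by blast+
      then show ?thesis by (simp add: e_def True algebra_simps)
    next
      case False
      then have "a < d" using less.prems sum_m by simp
      then show ?thesis using xy perm'[OF xy] False by (simp add: e_def)
    qed
    show ?thesis
    \<comment> \<open>The witness comes from solving \<open>perm_sum_split_off\<close> for
      \<open>perm_sum m\<close>.\<close>
    proof (intro exI[of _ "(e - (\<Sum>j | m' j > 0. c j)) / N"] conjI impI allI)
      assume "sum m UNIV < d"
      then show "(e - (\<Sum>j | m' j > 0. c j)) / N = 0"
        using c(1) sum_m by (simp add: e_def)
    next
      fix x y :: "real ^ 'n" assume xy: "\<forall>k<d. psum k x = psum k y"
      have "N * perm_sum m z = psum a z * perm_sum m' z
          - (\<Sum>j | m' j > 0. perm_sum (m'(j := m' j + a)) z)" for z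
        using perm_sum_split_off[of m i0 z, OF i0] unfolding N_def m'_def a_def .
      then have "N * (perm_sum m y - perm_sum m x) =
          (psum a y * perm_sum m' y - psum a x * perm_sum m' x)
          - (\<Sum>j | m' j > 0. perm_sum (m'(j := m' j + a)) y - perm_sum (m'(j := m' j + a)) x)"
        by (simp add: right_diff_distrib sum_subtractf)
      also have "\<dots> = e * (psum d y - psum d x) - (\<Sum>j | m' j > 0. c j * (psum d y - psum d x))"
        using prod[OF xy] c(2)[OF _ xy] by simp
      also have "\<dots> = (e - (\<Sum>j | m' j > 0. c j)) * (psum d y - psum d x)"
        by (simp add: left_diff_distrib sum_distrib_right)
      finally show "perm_sum m y - perm_sum m x =
          (e - (\<Sum>j | m' j > 0. c j)) / N * (psum d y - psum d x)"
        using N by (simp add: field_simps)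
    qed
  qed
qed

section \<open>Symmetric polynomials at points with equal lower power sums\<close>

text \<open>Permuting the arguments amounts to permuting the exponents by the inverse, which
  preserves the coefficients.\<close>

lemma eval_mpoly_permute:
  fixes p :: "'n::finite real_mpoly"
  assumes "symmetric p" and bij: "bij \<sigma>"
  shows "eval_mpoly p (\<chi> i. x $ \<sigma> i) = eval_mpoly p x"
proof -
  have inj: "inj \<sigma>" and bij': "bij (inv \<sigma>)"
    using bij by (auto simp: bij_is_inj bij_imp_bij_inv)
  have inj': "inj (inv \<sigma>)" using bij' by (simp add: bij_is_inj)
  have lookup: "Poly_Mapping.lookup (Poly_Mapping.map_key \<tau> m) = Poly_Mapping.lookup m \<circ> \<tau>"
    if "inj \<tau>" for \<tau> :: "'n \<Rightarrow> 'n" and m :: "'n \<Rightarrow>\<^sub>0 nat"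
    using that by (rule map_key.rep_eq)
  have sym: "Poly_Mapping.lookup p (Poly_Mapping.map_key \<tau> m) = Poly_Mapping.lookup p m"
    if "bij \<tau>" for \<tau> m
    using assms(1) that by (simp add: symmetric_def)
  show ?thesis unfolding eval_mpoly_def
  proof (rule sum.reindex_bij_witness[where i = "Poly_Mapping.map_key \<sigma>"
        and j = "Poly_Mapping.map_key (inv \<sigma>)"])
    fix m :: "'n \<Rightarrow>\<^sub>0 nat"
    show "Poly_Mapping.map_key \<sigma> (Poly_Mapping.map_key (inv \<sigma>) m) = m"
      "Poly_Mapping.map_key (inv \<sigma>) (Poly_Mapping.map_key \<sigma> m) = m"
      using bij by (auto intro!: poly_mapping_eqI
          simp: lookup[OF inj] lookup[OF inj'] bij_is_inj bij_is_surj surj_f_inv_f)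
    assume m: "m \<in> Poly_Mapping.keys p"
    then show "Poly_Mapping.map_key (inv \<sigma>) m \<in> Poly_Mapping.keys p"
      "Poly_Mapping.map_key \<sigma> m \<in> Poly_Mapping.keys p"
      by (simp_all add: in_keys_iff sym bij bij')
    have "(\<Prod>i\<in>UNIV. x $ \<sigma> i ^ Poly_Mapping.lookup m (inv \<sigma> (\<sigma> i))) =
        (\<Prod>i\<in>UNIV. x $ i ^ Poly_Mapping.lookup m (inv \<sigma> i))"
      using bij by (rule prod.reindex_bij_betw)
    then show "Poly_Mapping.lookup p (Poly_Mapping.map_key (inv \<sigma>) m) *
        (\<Prod>i\<in>UNIV. x $ i ^ Poly_Mapping.lookup (Poly_Mapping.map_key (inv \<sigma>) m) i) =
        Poly_Mapping.lookup p m * (\<Prod>i\<in>UNIV. (\<chi> i. x $ \<sigma> i) $ i ^ Poly_Mapping.lookup m i)"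
      by (simp add: sym bij' lookup[OF inj'] inj)
  qed
qed

lemma symmetric_eval_mpoly:
  fixes p :: "'n::finite real_mpoly"
  assumes "symmetric p"
  shows "real (card {\<sigma> :: 'n \<Rightarrow> 'n. bij \<sigma>}) * eval_mpoly p x =
    (\<Sum>m\<in>Poly_Mapping.keys p. Poly_Mapping.lookup p m * perm_sum (Poly_Mapping.lookup m) x)"
proof -
  have "real (card {\<sigma> :: 'n \<Rightarrow> 'n. bij \<sigma>}) * eval_mpoly p x =
      (\<Sum>\<sigma> :: 'n \<Rightarrow> 'n | bij \<sigma>. eval_mpoly p (\<chi> i. x $ \<sigma> i))"
    using eval_mpoly_permute[OF assms] by simp
  also have "\<dots> = (\<Sum>m\<in>Poly_Mapping.keys p. Poly_Mapping.lookup p m * perm_sum (Poly_Mapping.lookup m) x)"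
    unfolding eval_mpoly_def perm_sum_def
    by (subst sum.swap) (simp add: sum_distrib_left)
  finally show ?thesis .
qed

text \<open>The slope \<open>c\<close> depends on \<open>p\<close> alone, so it also serves all
  common shifts of two points.\<close>

lemma eval_mpoly_affine_in_psum:
  fixes p :: "'n::finite real_mpoly"
  assumes "homogeneous d p" "symmetric p"
  obtains c where "\<And>x y :: real ^ 'n. (\<And>k. k < d \<Longrightarrow> psum k x = psum k y) \<Longrightarrow>
    eval_mpoly p y - eval_mpoly p x = c * (psum d y - psum d x)"
proof -
  have "\<exists>c. \<forall>x y :: real ^ 'n. (\<forall>k<d. psum k x = psum k y) \<longrightarrow>
      perm_sum (Poly_Mapping.lookup m) y - perm_sum (Poly_Mapping.lookup m) x = c * (psum d y - psum d x)"
    if "m \<in> Poly_Mapping.keys p" for m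
    using perm_sum_affine_in_psum[of "Poly_Mapping.lookup m" d] assms(1) that
    unfolding homogeneous_def by auto
  then obtain c where c: "\<And>m x y. m \<in> Poly_Mapping.keys p \<Longrightarrow>
      (\<forall>k<d. psum k (x :: real ^ 'n) = psum k y) \<Longrightarrow>
      perm_sum (Poly_Mapping.lookup m) y - perm_sum (Poly_Mapping.lookup m) x = c m * (psum d y - psum d x)"
    by metis
  define N where "N = real (card {\<sigma> :: 'n \<Rightarrow> 'n. bij \<sigma>})"
  have "id \<in> {\<sigma> :: 'n \<Rightarrow> 'n. bij \<sigma>}" by simp
  then have N: "N > 0" unfolding N_def by (metis card_gt_0_iff empty_iff finite of_nat_0_less_iff)
  show ?thesis
  proof (rule that[of "(\<Sum>m\<in>Poly_Mapping.keys p. Poly_Mapping.lookup p m * c m) / N"])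
    fix x y :: "real ^ 'n" assume "\<And>k. k < d \<Longrightarrow> psum k x = psum k y"
    then have xy: "\<forall>k<d. psum k x = psum k y" by blast
    have "N * (eval_mpoly p y - eval_mpoly p x) = (\<Sum>m\<in>Poly_Mapping.keys p. Poly_Mapping.lookup p m *
        (perm_sum (Poly_Mapping.lookup m) y - perm_sum (Poly_Mapping.lookup m) x))"
      unfolding N_def right_diff_distrib symmetric_eval_mpoly[OF assms(2)] by (simp add: sum_subtractf)
    also have "\<dots> = (\<Sum>m\<in>Poly_Mapping.keys p. Poly_Mapping.lookup p m * c m) * (psum d y - psum d x)"
      using c[OF _ xy] by (simp add: sum_distrib_right mult.assoc)
    finally show "eval_mpoly p y - eval_mpoly p x =
        (\<Sum>m\<in>Poly_Mapping.keys p. Poly_Mapping.lookup p m * c m) / N * (psum d y - psum d x)"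
      using N by (simp add: field_simps)
  qed
qed

text \<open>Each monomial turns into a monic polynomial of degree \<open>d\<close>, so the
  coefficient of order \<open>d\<close> is \<open>eval_mpoly p 1\<close>.\<close>

lemma degree_line_poly:
  fixes p :: "'n::finite real_mpoly"
  assumes hom: "homogeneous d p" and "eval_mpoly p 1 \<noteq> 0"
  shows "degree (line_poly p x 1) = d"
proof -
  define q where "q m = (\<Prod>i\<in>UNIV. [:x $ i, 1:] ^ Poly_Mapping.lookup m i)" for m :: "'n \<Rightarrow>\<^sub>0 nat"
  have deg: "degree (q m) = (\<Sum>i\<in>UNIV. Poly_Mapping.lookup m i)" for m
    unfolding q_def by (subst degree_prod_sum_eq) (auto simp: degree_power_eq)
  have lead: "lead_coeff (q m) = 1" for m
    unfolding q_def by (simp add: lead_coeff_prod lead_coeff_power)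
  have line: "line_poly p x 1 = (\<Sum>m\<in>Poly_Mapping.keys p. smult (Poly_Mapping.lookup p m) (q m))"
    by (simp add: line_poly_def q_def)
  have degd: "degree (q m) = d" if "m \<in> Poly_Mapping.keys p" for m
    using hom that by (simp add: deg homogeneous_def)
  have "coeff (line_poly p x 1) d = (\<Sum>m\<in>Poly_Mapping.keys p. Poly_Mapping.lookup p m * coeff (q m) d)"
    by (simp add: line coeff_sum)
  also have "\<dots> = (\<Sum>m\<in>Poly_Mapping.keys p. Poly_Mapping.lookup p m)"
    using lead degd by (intro sum.cong) auto
  also have "\<dots> = eval_mpoly p 1" by (simp add: eval_mpoly_def)
  finally have "coeff (line_poly p x 1) d \<noteq> 0" using assms(2) by simp
  moreover have "degree (line_poly p x 1) \<le> d"
    unfolding line by (intro degree_sum_le) (auto intro: order_trans[OF degree_smult_le] simp: degd)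
  ultimately show ?thesis using le_degree by (metis order_antisym)
qed

section \<open>Extrema of a power sum when the lower ones are fixed\<close>

text \<open>The map sending \<open>z\<close> to its first \<open>d\<close> power sums, completed by the coordinates outside a set
  of \<open>d\<close> indices with distinct entries, has an invertible derivative at \<open>y\<close>: the relevant block
  is a Vandermonde matrix.\<close>

lemma psum_perturb:
  fixes y :: "real ^ 'n::finite"
  assumes "d \<ge> 1" and "card (range (\<lambda>i. y $ i)) \<ge> d"
  obtains r where "r > 0"
    "\<And>e. \<bar>e\<bar> < r \<Longrightarrow> \<exists>z :: real ^ 'n. (\<forall>k<d. psum k z = psum k y) \<and> psum d z = psum d y + e"
proof -
  obtain B where B: "B \<subseteq> range (\<lambda>i. y $ i)" "card B = d"
    using assms(2) by (metis obtain_subset_with_card_n)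
  then obtain I where inj: "inj_on (\<lambda>i. y $ i) I" and "B = (\<lambda>i. y $ i) ` I"
    by (auto simp: subset_image_inj)
  then have cardI: "card I = d" using B(2) by (simp add: card_image)
  \<comment> \<open>Orders start at 1, since the constant \<open>psum 0\<close> cannot serve as a
    coordinate.\<close>
  then obtain b where b: "bij_betw b I {1..d}"
    using finite_same_card_bij[of I "{1..d}"] by auto
  define F :: "real ^ 'n \<Rightarrow> real ^ 'n"
    where "F z = (\<chi> i. if i \<in> I then psum (b i) z else z $ i)" for z
  define F' :: "real ^ 'n \<Rightarrow> real ^ 'n"
    where "F' h = (\<chi> i. if i \<in> I then \<Sum>j\<in>UNIV. of_nat (b i) * y $ j ^ (b i - 1) * h $ j else h $ i)" for h
  have der: "(F has_derivative F') (at y)"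
  proof (subst has_derivative_componentwise_within, intro ballI)
    fix u :: "real ^ 'n" assume "u \<in> Basis"
    then obtain i where u: "u = axis i 1" by (auto simp: Basis_vec_def)
    have nth: "((\<lambda>z. z $ j) has_derivative (\<lambda>h. h $ j)) (at y)" for j :: 'n
      by (rule bounded_linear_imp_has_derivative[OF bounded_linear_vec_nth])
    show "((\<lambda>z. F z \<bullet> u) has_derivative (\<lambda>h. F' h \<bullet> u)) (at y)"
    proof (cases "i \<in> I")
      case True
      have "((\<lambda>z. \<Sum>j\<in>UNIV. z $ j ^ b i) has_derivative
          (\<lambda>h. \<Sum>j\<in>UNIV. of_nat (b i) * h $ j * y $ j ^ (b i - 1))) (at y)"
        by (intro has_derivative_sum has_derivative_power nth)
      then show ?thesis
        using True by (simp add: F_def F'_def u inner_axis psum_def mult_ac)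
    next
      case False
      then show ?thesis using nth by (simp add: F_def F'_def u inner_axis)
    qed
  qed
  have lin: "linear F'" using der by (rule has_derivative_linear)
  \<comment> \<open>A kernel vector \<open>h\<close> vanishes outside \<open>I\<close> and is
    orthogonal to the values at the entries of \<open>y\<close> of every polynomial of degree below
    \<open>d\<close>; an unnormalized Lagrange polynomial then isolates each
    \<open>h $ j\<close>.\<close>
  have "inj F'"
  proof (subst linear_injective_0[OF lin], intro allI impI)
    fix h assume "F' h = 0"
    then have comp: "F' h $ i = 0" for i by simp
    have out: "h $ i = 0" if "i \<notin> I" for i
      using comp[of i] that by (simp add: F'_def)
    have mom: "(\<Sum>j\<in>UNIV. y $ j ^ k * h $ j) = 0" if "k < d" for k
    proof -
      have "Suc k \<in> b ` I" using b that by (simp add: bij_betw_def)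
      then obtain i where "i \<in> I" "b i = Suc k" by auto
      then have "(\<Sum>j\<in>UNIV. of_nat (Suc k) * y $ j ^ k * h $ j) = 0"
        using comp[of i] by (simp add: F'_def)
      then have "of_nat (Suc k) * (\<Sum>j\<in>UNIV. y $ j ^ k * h $ j) = 0"
        by (simp only: sum_distrib_left mult.assoc)
      then show ?thesis by (simp del: of_nat_Suc)
    qed
    have lagrange: "(\<Sum>j\<in>UNIV. poly q (y $ j) * h $ j) = 0" if "degree q < d" for q
    proof -
      have "(\<Sum>j\<in>UNIV. poly q (y $ j) * h $ j) =
          (\<Sum>j\<in>UNIV. \<Sum>k\<le>degree q. coeff q k * (y $ j ^ k * h $ j))"
        by (simp add: poly_altdef sum_distrib_right mult.assoc)
      also have "\<dots> = (\<Sum>k\<le>degree q. coeff q k * (\<Sum>j\<in>UNIV. y $ j ^ k * h $ j))"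
        by (subst sum.swap) (simp add: sum_distrib_left)
      also have "\<dots> = 0" using mom that by simp
      finally show ?thesis .
    qed
    have "h $ j = 0" if j: "j \<in> I" for j
    proof -
      define q where "q = (\<Prod>i\<in>I - {j}. [:- y $ i, 1:])"
      have "degree q = card (I - {j})"
        unfolding q_def by (subst degree_prod_sum_eq) auto
      then have "degree q < d" using assms(1) cardI j by simp
      then have "(\<Sum>i\<in>UNIV. poly q (y $ i) * h $ i) = 0" by (rule lagrange)
      also have "(\<Sum>i\<in>UNIV. poly q (y $ i) * h $ i) = poly q (y $ j) * h $ j"
      proof -
        have "poly q (y $ i) * h $ i = 0" if "i \<noteq> j" for i
          using that out[of i] by (cases "i \<in> I") (auto simp: q_def poly_prod)
        then have "(\<Sum>i\<in>UNIV - {j}. poly q (y $ i) * h $ i) = 0"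
          by (intro sum.neutral) auto
        then show ?thesis by (subst sum.remove[of _ j]) simp_all
      qed
      finally have "poly q (y $ j) * h $ j = 0" .
      moreover have "poly q (y $ j) \<noteq> 0"
        using inj j by (auto simp: q_def poly_prod inj_on_def)
      ultimately show ?thesis by simp
    qed
    with out show "h = 0" by (auto simp: vec_eq_iff)
  qed
  then obtain G where G: "linear G" "F' \<circ> G = id"
    using linear_injective_imp_surjective[OF lin] linear_surjective_right_inverse[OF lin] by auto
  have "continuous_on UNIV F"
    unfolding F_def psum_def
  proof (rule continuous_on_vec_lambda)
    show "continuous_on UNIV (\<lambda>z :: real ^ 'n. if i \<in> I then \<Sum>j\<in>UNIV. z $ j ^ b i else z $ i)" for i
      by (cases "i \<in> I") (auto intro!: continuous_intros)
  qed
  \<comment> \<open>Open mapping at a single point: continuity of \<open>F\<close> and a right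
    inverse of its derivative at \<open>y\<close> suffice.\<close>
  then have "F y \<in> interior (range F)"
    using sussmann_open_mapping[OF open_UNIV _ _ der _ G(2), of UNIV] G(1)
    by (simp add: linear_conv_bounded_linear)
  then obtain r where r: "r > 0" "ball (F y) r \<subseteq> range F"
    by (auto simp: mem_interior)
  have "d \<in> b ` I" using b assms(1) by (simp add: bij_betw_def)
  then obtain i where i: "i \<in> I" "b i = d" by auto
  show ?thesis
  proof (rule that[OF r(1)])
    fix e :: real assume "\<bar>e\<bar> < r"
    then have "F y + e *\<^sub>R axis i 1 \<in> ball (F y) r"
      by (simp add: dist_norm)
    then obtain z where z: "F z = F y + e *\<^sub>R axis i 1" using r(2) by (metis imageE subsetD)
    have zk: "psum (b j) z = psum (b j) y + (if j = i then e else 0)" if "j \<in> I" for j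
    proof -
      have "F z $ j = F y $ j + e * axis i 1 $ j" by (simp add: z)
      then show ?thesis using that by (simp add: F_def axis_def split: if_splits)
    qed
    have "psum k z = psum k y" if "k < d" for k
    \<comment> \<open>\<open>psum 0\<close> is not a coordinate of \<open>F\<close>; it counts the
      variables.\<close>
    proof (cases "k = 0")
      case True
      then show ?thesis by (simp add: psum_def)
    next
      case False
      then have "k \<in> b ` I" using b that by (simp add: bij_betw_def)
      then obtain j where "j \<in> I" "b j = k" by auto
      then show ?thesis using zk[of j] i that by auto
    qed
    then show "\<exists>z :: real ^ 'n. (\<forall>k<d. psum k z = psum k y) \<and> psum d z = psum d y + e"
      using zk[OF i(1)] i(2) by auto
  qed
qed

lemma psum_extremal_few_entries:
  fixes x :: "real ^ 'n::finite"
  assumes "d \<ge> 3"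
  obtains u v :: "real ^ 'n" where
    "at_most_distinct_entries (d - 1) u" "\<And>k. k < d \<Longrightarrow> psum k x = psum k u"
    "at_most_distinct_entries (d - 1) v" "\<And>k. k < d \<Longrightarrow> psum k x = psum k v"
    "psum d u \<le> psum d x" "psum d x \<le> psum d v"
proof -
  have cont: "continuous_on S (psum k)" for k and S :: "(real ^ 'n) set"
    unfolding psum_def by (intro continuous_intros)
  define K where "K = (\<Inter>k\<in>{..<d}. {z :: real ^ 'n. psum k z = psum k x})"
  have memK: "z \<in> K \<longleftrightarrow> (\<forall>k<d. psum k z = psum k x)" for z by (auto simp: K_def)
  have "closed K"
    unfolding K_def by (intro closed_INT ballI closed_Collect_eq cont continuous_on_const)
  moreover have "bounded K"
    unfolding bounded_iff
  proof (intro exI ballI)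
    fix z assume "z \<in> K"
    then have "psum 2 z = psum 2 x" using assms by (simp add: memK)
    then show "norm z \<le> sqrt (psum 2 x)"
      by (simp add: norm_vec_def L2_set_def psum_def)
  qed
  ultimately have "compact K" by (simp add: compact_eq_bounded_closed)
  moreover have "K \<noteq> {}" "x \<in> K" by (auto simp: memK intro!: exI[of _ x])
  ultimately obtain u v where u: "u \<in> K" "\<And>z. z \<in> K \<Longrightarrow> psum d u \<le> psum d z"
    and v: "v \<in> K" "\<And>z. z \<in> K \<Longrightarrow> psum d z \<le> psum d v"
    using continuous_attains_inf[of K "psum d"] continuous_attains_sup[of K "psum d"] cont by metis
  have few: "at_most_distinct_entries (d - 1) w"
    if w: "w \<in> K" "(\<forall>z\<in>K. psum d w \<le> psum d z) \<or> (\<forall>z\<in>K. psum d z \<le> psum d w)" for w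
  proof (rule ccontr)
    assume "\<not> at_most_distinct_entries (d - 1) w"
    then have "card (range (\<lambda>i. w $ i)) \<ge> d" by (simp add: at_most_distinct_entries_def)
    then obtain r where r: "r > 0" "\<And>e. \<bar>e\<bar> < r \<Longrightarrow>
        \<exists>z :: real ^ 'n. (\<forall>k<d. psum k z = psum k w) \<and> psum d z = psum d w + e"
      using psum_perturb[of d w] assms by auto
    have "\<exists>z\<in>K. psum d z = psum d w + e" if "\<bar>e\<bar> < r" for e
      using r(2)[OF that] w(1) by (auto simp: memK)
    \<comment> \<open>One sign contradicts a maximum at \<open>w\<close>, the other a
      minimum.\<close>
    from this[of "r / 2"] this[of "- r / 2"] show False using w(2) r(1) by fastforce
  qed
  show ?thesis
  proof (rule that[of u v])
    show "at_most_distinct_entries (d - 1) u" "at_most_distinct_entries (d - 1) v"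
      using few u v by blast+
    show "psum d u \<le> psum d x" "psum d x \<le> psum d v"
      using u(2) v(2) \<open>x \<in> K\<close> by blast+
  qed (use u(1) v(1) memK in auto)
qed

section \<open>Hyperbolicity tested on points with few distinct entries\<close>

text \<open>The last hypothesis excludes a failure in degree 2: for the sum of squares in at least
  two variables, only diagonal points are tested, where the restriction is a multiple of a square,
  yet the polynomial is not hyperbolic. For \<open>d \<le> 1\<close> no point is tested and both
  sides hold.\<close>

theorem theorem3p3:
  fixes p :: "'n::finite real_mpoly" and d :: nat
  assumes "homogeneous d p"
    and "symmetric p"
    and "eval_mpoly p 1 \<noteq> 0"
    and "d = 2 \<longrightarrow> CARD('n) = 1"
  shows "symmetric_hyperbolic p \<longleftrightarrow>
    (\<forall>x :: real ^ 'n. at_most_distinct_entries (d - 1) x \<longrightarrow> only_real_roots (line_poly p x 1))"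
proof
  assume "symmetric_hyperbolic p"
  then show "\<forall>x :: real ^ 'n. at_most_distinct_entries (d - 1) x \<longrightarrow> only_real_roots (line_poly p x 1)"
    by (simp add: symmetric_hyperbolic_def hyperbolic_def)
next
  assume few: "\<forall>x :: real ^ 'n. at_most_distinct_entries (d - 1) x \<longrightarrow> only_real_roots (line_poly p x 1)"
  note deg = degree_line_poly[OF assms(1,3)]
  have "only_real_roots (line_poly p x 1)" for x
  proof -
    consider "d \<le> 1" | "d = 2" | "d \<ge> 3" by linarith
    then show ?thesis
    proof cases
      case 1
      \<comment> \<open>A zero restriction would force \<open>d = 0\<close>, but then
        \<open>p\<close> is a nonzero constant.\<close>
      have "line_poly p x 1 \<noteq> 0"
      proof
        assume "line_poly p x 1 = 0"
        then have "degree (line_poly p x 1 ) = 0" by simp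
        then have "d = 0" by (simp add: deg)
        then have "Poly_Mapping.lookup m i = 0" if "m \<in> Poly_Mapping.keys p" for m i
          using assms(1) that by (simp add: homogeneous_def)
        then have "eval_mpoly p x = eval_mpoly p 1" by (simp add: eval_mpoly_def)
        moreover have "eval_mpoly p x = poly (line_poly p x 1) 0" by (simp add: poly_line_poly)
        ultimately show False using \<open>line_poly p x 1 = 0\<close> assms(3) by simp
      qed
      then show ?thesis using 1 deg by (intro only_real_roots_degree_le_1) auto
    next
      case 2
      \<comment> \<open>With a single variable every point is a test point.\<close>
      have "card (range (\<lambda>i. x $ i)) \<le> CARD('n)" by (rule card_image_le) simp
      then show ?thesis using 2 assms(4) few by (auto simp: at_most_distinct_entries_def)
    next
      case 3
      obtain u v :: "real ^ 'n" where
        u: "at_most_distinct_entries (d - 1) u" "\<And>k. k < d \<Longrightarrow> psum k x = psum k u" and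
        v: "at_most_distinct_entries (d - 1) v" "\<And>k. k < d \<Longrightarrow> psum k x = psum k v" and
        uv: "psum d u \<le> psum d x" "psum d x \<le> psum d v"
        using psum_extremal_few_entries[OF 3] by blast
      obtain c where c: "\<And>x y :: real ^ 'n. (\<And>k. k < d \<Longrightarrow> psum k x = psum k y) \<Longrightarrow>
          eval_mpoly p y - eval_mpoly p x = c * (psum d y - psum d x)"
        using eval_mpoly_affine_in_psum[OF assms(1,2)] by blast
      define q where "q = line_poly p x 1"
      \<comment> \<open>A common shift keeps the lower power sums equal and the difference of order
        \<open>d\<close> fixed, so the values differ by the same number for every
        \<open>t\<close>.\<close>
      have line: "line_poly p y 1 = q + [:c * (psum d y - psum d x):]"
        if y: "\<And>k. k < d \<Longrightarrow> psum k x = psum k y" for y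
      proof (rule poly_eq_poly_eq_iff[THEN iffD1], rule ext)
        show "poly (line_poly p y 1) t = poly (q + [:c * (psum d y - psum d x):]) t" for t
          using c[of "x + t *\<^sub>R 1" "y + t *\<^sub>R 1"] y psum_shift_diff[of d x y t, OF y]
          by (simp add: q_def poly_line_poly psum_shift)
      qed
      have "degree q > 0" using 3 deg by (simp add: q_def)
      moreover have "only_real_roots (q + [:c * (psum d u - psum d x):])"
        "only_real_roots (q + [:c * (psum d v - psum d x):])"
        using few u v line by auto
      \<comment> \<open>The sign of \<open>c\<close> decides which of \<open>u\<close> and
        \<open>v\<close> gives the lower constant; \<open>q\<close> itself is the shift by
        0.\<close>
      moreover have "c * (psum d u - psum d x) \<le> 0 \<and> 0 \<le> c * (psum d v - psum d x) \<or>
          c * (psum d v - psum d x) \<le> 0 \<and> 0 \<le> c * (psum d u - psum d x)"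
        using uv by (cases "c \<ge> 0") (auto simp: mult_le_0_iff zero_le_mult_iff)
      ultimately have "only_real_roots (q + [:0:])"
        using only_real_roots_between by blast
      then show ?thesis by (simp add: q_def)
    qed
  qed
  then show "symmetric_hyperbolic p"
    using assms by (auto simp: symmetric_hyperbolic_def hyperbolic_def)
qed

end
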